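(* Let $\lambda,m,n,h,k$ be positive integers with $m\ge k$, $n\ge h$, $nk=mh$ and $2=\frac{2nk}{\lambda}+1$ (i.e. $\lambda=2nk$), and suppose $h\cdot k$ is odd. Then there exists a ${}^\lambda\mathrm{NH}(m,n;h,k)$ over $\mathbb{Z}_2$ (relative to the trivial subgroup).
   Context: An $m\times n$ partially filled (p.f.) array over a group $G$ (written additively) is an $m\times n$ matrix each of whose cells is either empty or contains an element of $G$. For a subgroup $J$ of order $t$, a $\lambda$-fold non-zero sum Heffter array ${}^\lambda\mathrm{NH}_t(m,n;h,k)$ over $G$ relative to $J$ is an $m\times n$ p.f. array $A$ over $G$ such that: (a) each row contains exactly $h$ filled cells and each column exactly $k$ filled cells; (b) the multiset obtained by taking, for every filled cell with entry $x$, the two elements $x$ and $-x$ (with multiplicity, so an involution contributes twice), is exactly the multiset containing each element of $G\setminus J$ exactly $\lambda$ times; (c) each row sum (left to right) and each column sum (top to bottom) is nonzero. When $t=1$ ($J$ trivial) the subscript is omitted: ${}^\lambda\mathrm{NH}(m,n;h,k)$. *)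

theory Defs
  imports "HOL-Algebra.Algebra" "HOL-Library.Multiset"
begin

text \<open>
  Groups are those of HOL-Algebra, hence written multiplicatively: sums become products,
  \<open>-x\<close> becomes \<open>inv x\<close> and zero becomes \<open>\<one>\<close>.
  Rows and columns are numbered from 0; an empty cell is \<open>None\<close>, and so is
  every position outside the \<open>m \<times> n\<close> rectangle.
\<close>

type_synonym 'a pf_array = "nat \<Rightarrow> nat \<Rightarrow> 'a option"

definition is_pf_array :: "('a, 'b) monoid_scheme \<Rightarrow> nat \<Rightarrow> nat \<Rightarrow> 'a pf_array \<Rightarrow> bool" where
  "is_pf_array G m n A \<longleftrightarrow>
     (\<forall>i j x. A i j = Some x \<longrightarrow> i < m \<and> j < n \<and> x \<in> carrier G)"

definition filled_cells :: "nat \<Rightarrow> nat \<Rightarrow> 'a pf_array \<Rightarrow> (nat \<times> nat) set" where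
  "filled_cells m n A = {(i, j). i < m \<and> j < n \<and> A i j \<noteq> None}"

definition row_entries :: "nat \<Rightarrow> 'a pf_array \<Rightarrow> nat \<Rightarrow> 'a list" where
  "row_entries n A i = List.map_filter (\<lambda>j. A i j) [0..<n]"

definition col_entries :: "nat \<Rightarrow> 'a pf_array \<Rightarrow> nat \<Rightarrow> 'a list" where
  "col_entries m A j = List.map_filter (\<lambda>i. A i j) [0..<m]"

text \<open>The ordered sum of a list; the order matters since \<open>G\<close> need not be abelian.\<close>

definition ordered_sum :: "('a, 'b) monoid_scheme \<Rightarrow> 'a list \<Rightarrow> 'a" where
  "ordered_sum G xs = foldr (\<otimes>\<^bsub>G\<^esub>) xs \<one>\<^bsub>G\<^esub>"

definition signed_entries ::
    "('a, 'b) monoid_scheme \<Rightarrow> nat \<Rightarrow> nat \<Rightarrow> 'a pf_array \<Rightarrow> 'a multiset" where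
  "signed_entries G m n A =
     (\<Sum>(i, j) \<in> filled_cells m n A. {# the (A i j), inv\<^bsub>G\<^esub> the (A i j) #})"

text \<open>
  \<open>is_rel_NH G J t l m n h k A\<close>: the array \<open>A\<close> is an \<open>l\<close>-fold non-zero sum Heffter array
  \<open>NH\<^sub>t(m,n;h,k)\<close> over \<open>G\<close> relative to the subgroup \<open>J\<close> of order \<open>t\<close>.
\<close>

definition is_rel_NH ::
    "('a, 'b) monoid_scheme \<Rightarrow> 'a set \<Rightarrow> nat \<Rightarrow> nat \<Rightarrow> nat \<Rightarrow> nat \<Rightarrow> nat \<Rightarrow> nat \<Rightarrow>
      'a pf_array \<Rightarrow> bool" where
  "is_rel_NH G J t l m n h k A \<longleftrightarrow>
     group G \<and> subgroup J G \<and> finite J \<and> card J = t \<and>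
     is_pf_array G m n A \<and>
     (\<forall>i<m. card {j. j < n \<and> A i j \<noteq> None} = h) \<and>
     (\<forall>j<n. card {i. i < m \<and> A i j \<noteq> None} = k) \<and>
     (\<forall>g. count (signed_entries G m n A) g = (if g \<in> carrier G - J then l else 0)) \<and>
     (\<forall>i<m. ordered_sum G (row_entries n A i) \<noteq> \<one>\<^bsub>G\<^esub>) \<and>
     (\<forall>j<n. ordered_sum G (col_entries m A j) \<noteq> \<one>\<^bsub>G\<^esub>)"

abbreviation is_NH ::
    "('a, 'b) monoid_scheme \<Rightarrow> nat \<Rightarrow> nat \<Rightarrow> nat \<Rightarrow> nat \<Rightarrow> nat \<Rightarrow> 'a pf_array \<Rightarrow> bool" where
  "is_NH G l m n h k A \<equiv> is_rel_NH G {\<one>\<^bsub>G\<^esub>} 1 l m n h k A"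

end

theory Submission
  imports Defs
begin

text \<open>
  The only nonzero element of \<open>\<int>\<^sub>2\<close> is its own inverse, so the array with 1 in all filled cells
  works as soon as each row has \<open>h\<close> and each column \<open>k\<close> filled cells: the row and column sums are
  the residues of the odd numbers \<open>h\<close> and \<open>k\<close>. For the pattern of filled cells, write
  \<open>0, \<dots>, mh - 1 = nk - 1\<close> cyclically along the columns, \<open>h\<close> consecutive numbers in each row; that is,
  put \<open>t\<close> into the cell \<open>(t div h, t mod n)\<close>.
\<close>

definition cyclic_pattern :: "nat \<Rightarrow> nat \<Rightarrow> nat \<Rightarrow> (nat \<times> nat) set" where
  "cyclic_pattern m n h = (\<lambda>t. (t div h, t mod n)) ` {..<m * h}"

lemma cyclic_pattern_bounds:
  assumes "0 < n" and "(i, j) \<in> cyclic_pattern m n h"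
  shows "i < m" and "j < n"
  using assms by (auto simp: cyclic_pattern_def less_mult_imp_div_less)

text \<open>Numbers congruent mod \<open>n\<close> differ by a multiple of \<open>n\<close>, and in
  a window of length \<open>n\<close> the only such difference is 0.\<close>

lemma inj_on_mod_interval: "inj_on (\<lambda>t::nat. t mod n) {a..<a + n}"
proof -
  have "s = t" if "s mod n = t mod n" "a \<le> s" "s \<le> t" "t < a + n" for s t
  proof -
    have "n dvd t - s"
      using that(1,3) by (metis mod_eq_dvd_iff_nat)
    moreover have "t - s < n"
      using that by linarith
    ultimately show ?thesis
      using that(3) nat_dvd_not_less[of "t - s" n] by linarith
  qed
  then show ?thesis
    by (intro inj_onI) (metis atLeastLessThan_iff nle_le)
qed

text \<open>The numbers written into row \<open>i\<close> form the block
  \<open>{i * h..<i * h + h}\<close>. As \<open>h \<le> n\<close>, their residues mod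
  \<open>n\<close> are distinct, so no two of them share a cell.\<close>

lemma card_row_cyclic_pattern:
  assumes "0 < h" and "h \<le> n" and "i < m"
  shows "card {j. (i, j) \<in> cyclic_pattern m n h} = h"
proof -
  \<comment> \<open>Since \<open>i < m\<close>, the bound \<open>m * h\<close> does not cut off any
    of the block.\<close>
  have lt: "t < m * h" if "t div h = i" for t
    using assms that by (metis div_less_iff_less_mult)
  have "t div h = i \<longleftrightarrow> t \<in> {i * h..<i * h + h}" for t
  proof
    assume "t div h = i"
    then show "t \<in> {i * h..<i * h + h}"
      using dividend_less_div_times[OF assms(1), of t] by auto
  next
    assume "t \<in> {i * h..<i * h + h}"
    then show "t div h = i"
      by (intro div_nat_eqI) (simp_all add: mult.commute)
  qed
  then have "{t. t < m * h \<and> t div h = i} = {i * h..<i * h + h}"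
    using lt by blast
  moreover have "{j. (i, j) \<in> cyclic_pattern m n h} = (\<lambda>t. t mod n) ` {t. t < m * h \<and> t div h = i}"
    by (auto simp: cyclic_pattern_def)
  moreover have "inj_on (\<lambda>t. t mod n) {i * h..<i * h + h}"
    using inj_on_subset[OF inj_on_mod_interval] assms(2) by (metis add_left_mono ivl_subset order_refl)
  ultimately show ?thesis
    by (simp add: card_image)
qed

text \<open>As \<open>m * h = n * k\<close>, the numbering runs through exactly \<open>k\<close>
  full cycles of the columns, and each cycle visits column \<open>j\<close> once. Successive visits
  are \<open>n \<ge> h\<close> apart, so each lies in a later row than the one before.\<close>

lemma card_col_cyclic_pattern:
  assumes "0 < h" and "h \<le> n" and "n * k = m * h" and "j < n"
  shows "card {i. (i, j) \<in> cyclic_pattern m n h} = k"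
proof -
  have "t < m * h \<and> t mod n = j \<longleftrightarrow> (\<exists>q<k. t = j + q * n)" for t
  proof
    assume "t < m * h \<and> t mod n = j"
    then have "t div n < k"
      using assms(3) by (simp add: less_mult_imp_div_less mult.commute)
    moreover have "t = j + t div n * n"
      using \<open>t < m * h \<and> t mod n = j\<close> by (metis mod_div_mult_eq)
    ultimately show "\<exists>q<k. t = j + q * n"
      by blast
  next
    assume "\<exists>q<k. t = j + q * n"
    then obtain q where q: "q < k" "t = j + q * n"
      by blast
    \<comment> \<open>The visit to column \<open>j\<close> in cycle \<open>q\<close> comes before
      that cycle ends, at \<open>Suc q * n\<close>, hence before the end
      \<open>k * n = m * h\<close> of the numbering.\<close>
    have "t < Suc q * n"
      using q assms(4) by simp
    also have "\<dots> \<le> k * n"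
      using q by (intro mult_le_mono1) simp
    finally show "t < m * h \<and> t mod n = j"
      using q assms by (simp add: mult.commute)
  qed
  then have "{t. t < m * h \<and> t mod n = j} = (\<lambda>q. j + q * n) ` {..<k}"
    by (simp only: image_def lessThan_iff Bex_def)
  moreover have "{i. (i, j) \<in> cyclic_pattern m n h} = (\<lambda>t. t div h) ` {t. t < m * h \<and> t mod n = j}"
    by (auto simp: cyclic_pattern_def)
  ultimately have "{i. (i, j) \<in> cyclic_pattern m n h} = (\<lambda>q. (j + q * n) div h) ` {..<k}"
    by (simp only: image_image)
  moreover have "inj (\<lambda>q. (j + q * n) div h)"
  proof -
    have "(j + q * n) div h < (j + Suc q * n) div h" for q
    proof -
      \<comment> \<open>Adding \<open>h\<close> raises the quotient by exactly 1; adding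
        \<open>n \<ge> h\<close> raises it at least as much.\<close>
      have "(j + q * n) div h < (j + q * n + h) div h"
        using assms(1) by simp
      also have "\<dots> \<le> (j + Suc q * n) div h"
        using assms(2) by (intro div_le_mono) simp
      finally show ?thesis .
    qed
    then show ?thesis
      by (intro strict_mono_imp_inj_on) (simp add: strict_mono_Suc_iff)
  qed
  ultimately show ?thesis
    by (simp add: card_image inj_on_subset)
qed

lemma length_map_filter_distinct:
  assumes "distinct xs"
  shows "length (List.map_filter f xs) = card {x \<in> set xs. f x \<noteq> None}"
  using assms by (simp add: List.map_filter_def distinct_length_filter Int_def conj_commute)

text \<open>Here \<open>1\<close> is the integer representing the nonzero residue; the neutral
  element of the group is 0.\<close>

lemma ordered_sum_replicate_one:
  "ordered_sum (integer_mod_group 2) (replicate r 1) = int r mod 2"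
  by (induction r) (auto simp: ordered_sum_def mult_integer_mod_group mod_simps add.commute)

text \<open>A list of ones is determined by its length, here the number of filled cells; when this
  is odd, the sum is 1. The function \<open>f\<close> can be a row or a column of the array.\<close>

lemma ordered_sum_ones_neq_one:
  assumes "\<And>x. f x \<noteq> None \<Longrightarrow> f x = Some 1" and "odd (card {x. x < r \<and> f x \<noteq> None})"
  shows "ordered_sum (integer_mod_group 2) (List.map_filter f [0..<r]) \<noteq> \<one>\<^bsub>integer_mod_group 2\<^esub>"
proof -
  let ?xs = "List.map_filter f [0..<r]"
  have "y = 1" if "y \<in> set ?xs" for y
    using that assms(1) by (force simp: List.map_filter_def)
  then have "?xs = replicate (length ?xs) 1"
    by (metis replicate_eqI)
  moreover have "length ?xs = card {x. x < r \<and> f x \<noteq> None}"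
    by (simp add: length_map_filter_distinct)
  ultimately have "ordered_sum (integer_mod_group 2) ?xs = int (card {x. x < r \<and> f x \<noteq> None}) mod 2"
    by (metis ordered_sum_replicate_one)
  also have "\<dots> = 1"
    using assms(2) by presburger
  finally show ?thesis
    by simp
qed

theorem theorem2p2:
  fixes l m n h k :: nat
  assumes "l > 0" and "m > 0" and "n > 0" and "h > 0" and "k > 0"
    and "m \<ge> k" and "n \<ge> h"
    and "n * k = m * h"
    and "(2::real) = 2 * real n * real k / real l + 1"
    and "odd (h * k)"
  shows "\<exists>A. is_NH (integer_mod_group 2) l m n h k A"
proof -
  let ?G = "integer_mod_group 2"
  let ?P = "cyclic_pattern m n h"
  define A :: "int pf_array" where "A = (\<lambda>i j. if (i, j) \<in> ?P then Some 1 else None)"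
  note bounds = cyclic_pattern_bounds[OF \<open>n > 0\<close>, where m = m and h = h]
  \<comment> \<open>Clear the denominator \<open>real l\<close>, which is nonzero because
    \<open>l > 0\<close>.\<close>
  have "real l = real (2 * (n * k))"
    using assms(1,9) by (simp add: field_simps)
  then have l: "l = 2 * (n * k)"
    by linarith
  have rows: "{j. j < n \<and> A i j \<noteq> None} = {j. (i, j) \<in> ?P}" for i
    using bounds by (auto simp: A_def)
  have cols: "{i. i < m \<and> A i j \<noteq> None} = {i. (i, j) \<in> ?P}" for j
    using bounds by (auto simp: A_def)
  have card_row: "card {j. j < n \<and> A i j \<noteq> None} = h" if "i < m" for i
    using that assms unfolding rows by (simp add: card_row_cyclic_pattern)
  have card_col: "card {i. i < m \<and> A i j \<noteq> None} = k" if "j < n" for j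
    using that assms unfolding cols by (simp add: card_col_cyclic_pattern)
  have inv1: "inv\<^bsub>?G\<^esub> 1 = (1::int)"
    by (simp add: inv_integer_mod_group carrier_integer_mod_group)
  \<comment> \<open>Counting row by row gives \<open>m * h\<close>, which equals
    \<open>n * k\<close>.\<close>
  have card_cells: "card (filled_cells m n A) = n * k"
  proof -
    have "filled_cells m n A = (SIGMA i:{..<m}. {j. j < n \<and> A i j \<noteq> None})"
      by (auto simp: filled_cells_def)
    then show ?thesis
      using card_row assms(8) by simp
  qed
  \<comment> \<open>Since \<open>1\<close> is its own inverse, every filled cell contributes it
    twice; over \<open>n * k\<close> cells this gives multiplicity
    \<open>2 * (n * k) = l\<close>.\<close>
  have "signed_entries ?G m n A = (\<Sum>c \<in> filled_cells m n A. {#1, 1#})"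
    unfolding signed_entries_def
    by (intro sum.cong) (auto simp: filled_cells_def A_def inv1 split: if_splits)
  then have "count (signed_entries ?G m n A) g = (\<Sum>c \<in> filled_cells m n A. if g = 1 then 2 else 0)" for g
    by (simp add: count_sum)
  then have count: "count (signed_entries ?G m n A) g = (if g = 1 then l else 0)" for g
    by (simp add: card_cells l)
  have carrier: "g \<in> carrier ?G - {\<one>\<^bsub>?G\<^esub>} \<longleftrightarrow> g = 1" for g
    by (auto simp: carrier_integer_mod_group)
  have "odd h" "odd k"
    using assms(10) by simp_all
  have "is_NH ?G l m n h k A"
    unfolding is_rel_NH_def
  proof (intro conjI allI impI)
    show "group ?G"
      by simp
    show "subgroup {\<one>\<^bsub>?G\<^esub>} ?G"
      by (intro group.triv_subgroup) simp
    show "is_pf_array ?G m n A"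
      using bounds by (auto simp: is_pf_array_def A_def carrier_integer_mod_group split: if_splits)
    show "count (signed_entries ?G m n A) g = (if g \<in> carrier ?G - {\<one>\<^bsub>?G\<^esub>} then l else 0)" for g
      unfolding carrier count ..
    show "ordered_sum ?G (row_entries n A i) \<noteq> \<one>\<^bsub>?G\<^esub>" if "i < m" for i
      unfolding row_entries_def
      using card_row[OF that] \<open>odd h\<close> by (intro ordered_sum_ones_neq_one) (simp_all add: A_def split: if_splits)
    show "ordered_sum ?G (col_entries m A j) \<noteq> \<one>\<^bsub>?G\<^esub>" if "j < n" for j
      unfolding col_entries_def
      using card_col[OF that] \<open>odd k\<close> by (intro ordered_sum_ones_neq_one) (simp_all add: A_def split: if_splits)
  qed (auto intro: card_row card_col simp del: not_None_eq)
  then show ?thesis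
    by blast
qed

end
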